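(* For any $A, B$ in the gyrovector space $(\mathbb{P}_{n}, \oplus, \circ)$ and any $t \in [0,1]$, $$L(t; A, B) = A \#_{t} B, \qquad L^{c}(t; A, B) = A \natural_{t} B,$$ where $L(t;A,B)$ and $L^{c}(t;A,B)$ are the gyroline and the cogyroline through $A$ and $B$.
   Context: $\mathbb{P}_{n}$ is the set of $n \times n$ positive definite Hermitian complex matrices. For $A, B \in \mathbb{P}_n$ and $t \in \mathbb{R}$ put $A \oplus B := A^{1/2} B A^{1/2}$ and $t \circ A := A^{t}$; the inverse of $A$ for $\oplus$ is $\ominus A = (-1) \circ A = A^{-1}$. With these operations $(\mathbb{P}_n, \oplus, \circ)$ is a gyrovector space, whose gyroautomorphisms are determined by $\mathrm{gyr}[A,B]X = \ominus(A \oplus B) \oplus [A \oplus (B \oplus X)]$; explicitly $\mathrm{gyr}[A,B] X = U(A,B) X U(A,B)^{-1}$ with $U(A,B) = (A^{1/2} B A^{1/2})^{-1/2} A^{1/2} B^{1/2}$ unitary. The gyrogroup cooperation is $A \boxplus B := A \oplus \mathrm{gyr}[A, \ominus B] B$. The gyroline is $L(t; A, B) := A \oplus t \circ (\ominus A \oplus B)$ and the cogyroline is $L^{c}(t; A, B) := t \circ (\ominus A \boxplus B) \oplus A$ (the scalar multiplication binds more tightly than $\oplus$). The weighted geometric mean is $A \#_{t} B := A^{1/2} (A^{-1/2} B A^{-1/2})^{t} A^{1/2}$, with $A \# B := A \#_{1/2} B$, and the weighted spectral geometric mean is $A \natural_{t} B := (A^{-1} \# B)^{t} A (A^{-1} \#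 B)^{t}$. *)

theory Defs
  imports "HOL-Analysis.Analysis"
begin

definition conj_transpose :: "complex^'n^'m \<Rightarrow> complex^'m^'n" where
  "conj_transpose A = (\<chi> i j. cnj (A $ j $ i))"

definition unitary :: "complex^'n^'n \<Rightarrow> bool" where
  "unitary U \<longleftrightarrow> conj_transpose U ** U = mat 1 \<and> U ** conj_transpose U = mat 1"

definition real_diag :: "('n \<Rightarrow> real) \<Rightarrow> complex^'n^'n" where
  "real_diag d = (\<chi> i j. if i = j then complex_of_real (d i) else 0)"

text \<open>For Hermitian \<open>A\<close> the number \<open>x\<^sup>* A x\<close> is real, so positivity of its real part is
  positivity of the form.\<close>

definition pos_def_mats :: "(complex^'n^'n) set" (\<open>\<bbbP>\<close>) where
  "\<bbbP> = {A. conj_transpose A = A \<and>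
        (\<forall>x. x \<noteq> 0 \<longrightarrow> 0 < Re (\<Sum>i\<in>UNIV. cnj (x $ i) * (A *v x) $ i))}"

text \<open>The real power \<open>A\<^sup>t\<close> is given by functional calculus: \<open>A = U D U\<^sup>*\<close> with \<open>U\<close> unitary and \<open>D\<close>
  positive diagonal yields \<open>A\<^sup>t = U D\<^sup>t U\<^sup>*\<close>. The following lemma shows that the choice of
  diagonalization is irrelevant, and the spectral theorem supplies one for every \<open>A \<in> \<bbbP>\<close>.
  Outside \<open>\<bbbP>\<close> the value is unspecified.\<close>

definition is_mat_powr :: "complex^'n^'n \<Rightarrow> real \<Rightarrow> complex^'n^'n \<Rightarrow> bool" where
  "is_mat_powr A t X \<longleftrightarrow> (\<exists>U d. unitary U \<and> (\<forall>i. 0 < d i) \<and>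
     A = U ** real_diag d ** conj_transpose U \<and>
     X = U ** real_diag (\<lambda>i. d i powr t) ** conj_transpose U)"

lemma real_diag_mult: "(real_diag d ** W) $ i $ j = of_real (d i) * W $ i $ j"
  "(W ** real_diag d) $ i $ j = W $ i $ j * of_real (d j)"
  by (simp_all add: real_diag_def matrix_matrix_mult_def if_distrib if_distribR cong: if_cong)

lemma is_mat_powr_unique:
  assumes "is_mat_powr A t X" and "is_mat_powr A t Y"
  shows "X = Y"
proof -
  obtain U d where U: "unitary U" and A1: "A = U ** real_diag d ** conj_transpose U"
    and X: "X = U ** real_diag (\<lambda>i. d i powr t) ** conj_transpose U"
    using assms(1) unfolding is_mat_powr_def by blast
  obtain V e where V: "unitary V" and A2: "A = V ** real_diag e ** conj_transpose V"
    and Y: "Y = V ** real_diag (\<lambda>i. e i powr t) ** conj_transpose V"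
    using assms(2) unfolding is_mat_powr_def by blast
  have u: "conj_transpose U ** U = mat 1" "U ** conj_transpose U = mat 1"
    and v: "conj_transpose V ** V = mat 1" "V ** conj_transpose V = mat 1"
    using U V by (auto simp: unitary_def)
  define W where "W = conj_transpose V ** U"
  have "real_diag e ** W = conj_transpose V ** (V ** real_diag e ** conj_transpose V) ** U"
    unfolding W_def by (metis matrix_mul_assoc matrix_mul_lid v(1))
  also have "\<dots> = conj_transpose V ** (U ** real_diag d ** conj_transpose U) ** U"
    using A1 A2 by simp
  also have "\<dots> = W ** real_diag d"
    unfolding W_def by (metis matrix_mul_assoc matrix_mul_rid u(1))
  finally have W: "real_diag e ** W = W ** real_diag d" .
  have "real_diag (\<lambda>i. e i powr t) ** W = W ** real_diag (\<lambda>i. d i powr t)"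
  proof -
    have "of_real (e i powr t) * W $ i $ j = W $ i $ j * of_real (d j powr t)" for i j
    proof -
      have "of_real (e i) * W $ i $ j = W $ i $ j * of_real (d j)"
        using W by (metis real_diag_mult)
      then show ?thesis by (cases "W $ i $ j = 0") auto
    qed
    then show ?thesis by (simp add: vec_eq_iff real_diag_mult)
  qed
  then have "V ** (real_diag (\<lambda>i. e i powr t) ** W) ** conj_transpose U
      = V ** (W ** real_diag (\<lambda>i. d i powr t)) ** conj_transpose U" by simp
  moreover have "W ** conj_transpose U = conj_transpose V" "V ** W = U"
    unfolding W_def by (metis matrix_mul_assoc matrix_mul_rid u(2))
      (metis matrix_mul_assoc matrix_mul_lid v(2))
  ultimately show ?thesis
    unfolding X Y by (metis matrix_mul_assoc)
qed

definition mat_powr :: "complex^'n^'n \<Rightarrow> real \<Rightarrow> complex^'n^'n"  (infixr \<open>\<up>\<close> 80) where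
  "A \<up> t = (THE X. is_mat_powr A t X)"

definition gyro_add :: "complex^'n^'n \<Rightarrow> complex^'n^'n \<Rightarrow> complex^'n^'n"  (infixl \<open>\<oplus>\<close> 65) where
  "A \<oplus> B = A \<up> (1/2) ** B ** A \<up> (1/2)"

definition gyro_scale :: "real \<Rightarrow> complex^'n^'n \<Rightarrow> complex^'n^'n"  (infixr \<open>\<odot>\<close> 75) where
  "t \<odot> A = A \<up> t"

definition gyro_inv :: "complex^'n^'n \<Rightarrow> complex^'n^'n"  (\<open>\<ominus> _\<close> [81] 80) where
  "\<ominus> A = matrix_inv A"

definition gyr :: "complex^'n^'n \<Rightarrow> complex^'n^'n \<Rightarrow> complex^'n^'n \<Rightarrow> complex^'n^'n" where
  "gyr A B X = \<ominus> (A \<oplus> B) \<oplus> (A \<oplus> (B \<oplus> X))"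

definition gyro_coadd :: "complex^'n^'n \<Rightarrow> complex^'n^'n \<Rightarrow> complex^'n^'n"  (infixl \<open>\<boxplus>\<close> 65) where
  "A \<boxplus> B = A \<oplus> gyr A (\<ominus> B) B"

definition gyroline :: "real \<Rightarrow> complex^'n^'n \<Rightarrow> complex^'n^'n \<Rightarrow> complex^'n^'n" where
  "gyroline t A B = A \<oplus> t \<odot> (\<ominus> A \<oplus> B)"

definition cogyroline :: "real \<Rightarrow> complex^'n^'n \<Rightarrow> complex^'n^'n \<Rightarrow> complex^'n^'n" where
  "cogyroline t A B = t \<odot> (\<ominus> A \<boxplus> B) \<oplus> A"

definition geo_mean :: "real \<Rightarrow> complex^'n^'n \<Rightarrow> complex^'n^'n \<Rightarrow> complex^'n^'n" where
  "geo_mean t A B =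
     A \<up> (1/2) ** (A \<up> (-1/2) ** B ** A \<up> (-1/2)) \<up> t ** A \<up> (1/2)"

definition spectral_geo_mean :: "real \<Rightarrow> complex^'n^'n \<Rightarrow> complex^'n^'n \<Rightarrow> complex^'n^'n" where
  "spectral_geo_mean t A B =
     geo_mean (1/2) (matrix_inv A) B \<up> t ** A ** geo_mean (1/2) (matrix_inv A) B \<up> t"

end

theory Submission
  imports Defs
begin

text \<open>All real powers of one \<open>A \<in> \<bbbP>\<close> are diagonal in a common orthonormal eigenbasis, so they
  obey the usual exponent laws. With \<open>X = \<ominus> A\<close> and \<open>C = X \<oplus> \<ominus> B\<close> one finds
  \<open>gyr[X, \<ominus> B] B = \<ominus> C \<oplus> X = C\<^sup>-\<^sup>1\<^sup>/\<^sup>2 X C\<^sup>-\<^sup>1\<^sup>/\<^sup>2\<close>, because \<open>\<ominus> B \<oplus> B\<close> is the identity. Hence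
  \<open>X \<boxplus> B = (X\<^sup>1\<^sup>/\<^sup>2 C\<^sup>-\<^sup>1\<^sup>/\<^sup>2 X\<^sup>1\<^sup>/\<^sup>2)\<^sup>2\<close> is the square of the geometric mean of \<open>X\<close> and \<open>B\<close>,
  and the outer square root in \<open>\<oplus>\<close> cancels this square.\<close>

subsection \<open>Spectral theorem\<close>

text \<open>Variational argument: the quadratic form \<open>x \<bullet> f x\<close> attains its
  maximum on the compact unit sphere of \<open>V\<close>, and every maximizer there is an
  eigenvector with the maximum as eigenvalue.\<close>

lemma selfadjoint_eigenvector:
  fixes f :: "'a::euclidean_space \<Rightarrow> 'a"
  assumes f: "linear f" and sa: "\<And>x y. x \<bullet> f y = f x \<bullet> y"
    and V: "subspace V" "f ` V \<subseteq> V" "\<not> V \<subseteq> {0}"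
  obtains x l where "x \<in> V" "norm x = 1" "f x = l *\<^sub>R x"
proof -
  let ?S = "V \<inter> sphere 0 1"
  obtain v where v: "v \<in> V" "v \<noteq> 0" using V by blast
  have "(1 / norm v) *\<^sub>R v \<in> ?S"
    using v V(1) by (simp add: subspace_scale)
  then have ne: "?S \<noteq> {}" by blast
  have cpt: "compact ?S"
    using closed_subspace[OF V(1)] by (simp add: closed_Int_compact)
  have "continuous_on ?S (\<lambda>x. x \<bullet> f x)"
    using linear_continuous_on[of f] f by (intro continuous_intros) (simp add: linear_conv_bounded_linear)
  from continuous_attains_sup[OF cpt ne this]
  obtain x where x: "x \<in> ?S" and mx: "\<And>y. y \<in> ?S \<Longrightarrow> y \<bullet> f y \<le> x \<bullet> f x" by blast
  define l where "l = x \<bullet> f x"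
  have nx: "norm x = 1" and xV: "x \<in> V" using x by auto
  have xx: "x \<bullet> x = 1" using nx by (simp add: dot_square_norm)
  have bound: "y \<bullet> f y \<le> l * (y \<bullet> y)" if "y \<in> V" for y
  proof (cases "y = 0")
    case False
    let ?z = "(1 / norm y) *\<^sub>R y"
    have "?z \<in> ?S" using that False V(1) by (simp add: subspace_scale)
    from mx[OF this] have "(y \<bullet> f y) / (y \<bullet> y) \<le> l"
      by (simp add: l_def linear_scale[OF f] dot_square_norm power2_eq_square)
    moreover have "0 < y \<bullet> y" using False by simp
    ultimately show ?thesis by (simp add: divide_le_eq)
  qed simp
  \<comment> \<open>The residual of the eigenvalue equation. It stays in \<open>V\<close> by
    invariance, so it is an admissible direction of perturbation.\<close>
  define w where "w = f x - l *\<^sub>R x"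
  have wV: "w \<in> V"
    using V xV unfolding w_def by (auto intro!: subspace_diff subspace_scale)
  define c where "c = l * (w \<bullet> w) - w \<bullet> f w"
  \<comment> \<open>Expanding \<open>bound\<close> at \<open>x + s *\<^sub>R w\<close>: the
    zeroth-order terms cancel, leaving a linear term in \<open>s\<close> against a quadratic
    one.\<close>
  have key: "2 * s * (w \<bullet> w) \<le> s\<^sup>2 * c" for s
  proof -
    have "x + s *\<^sub>R w \<in> V" using V(1) xV wV by (simp add: subspace_add subspace_scale)
    from bound[OF this]
    have "x \<bullet> f x + s * (x \<bullet> f w) + s * (w \<bullet> f x) + s * (s * (w \<bullet> f w))
      \<le> l * (x \<bullet> x + s * (x \<bullet> w) + s * (w \<bullet> x) + s * (s * (w \<bullet> w)))"
      by (simp add: linear_add[OF f] linear_scale[OF f] inner_add_left inner_add_right algebra_simps)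
    moreover have "x \<bullet> f w = w \<bullet> f x"
      unfolding sa[of x w] by (rule inner_commute)
    moreover have "x \<bullet> w = w \<bullet> x"
      by (rule inner_commute)
    moreover have "w \<bullet> f x = w \<bullet> w + l * (w \<bullet> x)"
      using inner_diff_right[of w "f x" "l *\<^sub>R x"] by (simp flip: w_def)
    ultimately show ?thesis
      using xx unfolding c_def l_def[symmetric]
      by (simp add: power2_eq_square algebra_simps)
  qed
  have "w \<bullet> w = 0"
  proof (rule ccontr)
    assume "w \<bullet> w \<noteq> 0"
    then have p: "0 < w \<bullet> w" by simp
    \<comment> \<open>The choice \<open>s = 1\<close> forces \<open>c\<close> to be positive. Then
      \<open>s = (w \<bullet> w) / c\<close>, small enough for the linear term to dominate, gives
      the contradiction.\<close>
    have "2 * (w \<bullet> w) \<le> c" using key[of 1] by simp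
    then have c: "0 < c" using p by linarith
    have "2 * ((w \<bullet> w) / c) * (w \<bullet> w) \<le> ((w \<bullet> w) / c)\<^sup>2 * c" by (rule key)
    then have "(w \<bullet> w) * (w \<bullet> w) \<le> 0" using c by (simp add: power2_eq_square field_simps)
    then show False using mult_pos_pos[OF p p] by linarith
  qed
  then have "f x = l *\<^sub>R x" by (simp add: w_def)
  then show ?thesis using that xV nx by blast
qed

section \<open>Complex inner product and its relation to the real one\<close>

definition herm_inner :: "complex^'n \<Rightarrow> complex^'n \<Rightarrow> complex" where
  "herm_inner x y = (\<Sum>i\<in>UNIV. cnj (x $ i) * y $ i)"

lemma Re_herm_inner: "Re (herm_inner x y) = x \<bullet> y"
  by (simp add: herm_inner_def inner_vec_def inner_complex_def)

lemma cnj_herm_inner: "cnj (herm_inner x y) = herm_inner y x"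
  by (simp add: herm_inner_def mult.commute)

lemma herm_inner_add_right: "herm_inner x (y + z) = herm_inner x y + herm_inner x z"
  by (simp add: herm_inner_def distrib_left sum.distrib)

lemma herm_inner_scaleR:
  "herm_inner x (r *\<^sub>R y) = of_real r * herm_inner x y"
  "herm_inner (r *\<^sub>R x) y = of_real r * herm_inner x y"
  by (simp_all add: herm_inner_def scaleR_conv_of_real[where 'a=complex]
      sum_distrib_left mult.left_commute mult.assoc)

lemma herm_inner_adjoint: "herm_inner x (A *v y) = herm_inner (conj_transpose A *v x) y"
proof -
  have "herm_inner x (A *v y) = (\<Sum>i\<in>UNIV. \<Sum>j\<in>UNIV. cnj (x $ i) * (A $ i $ j * y $ j))"
    by (simp add: herm_inner_def matrix_vector_mult_def sum_distrib_left)
  also have "\<dots> = (\<Sum>j\<in>UNIV. \<Sum>i\<in>UNIV. cnj (x $ i) * (A $ i $ j * y $ j))"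
    by (rule sum.swap)
  also have "\<dots> = herm_inner (conj_transpose A *v x) y"
    by (simp add: herm_inner_def matrix_vector_mult_def conj_transpose_def sum_distrib_left mult_ac)
  finally show ?thesis .
qed

text \<open>Multiplying the first argument by the imaginary unit turns the imaginary part into a
  real part. Complex orthogonality thus becomes two real conditions, to which real dimension
  counting applies.\<close>

lemma herm_inner_eq_0_iff: "herm_inner x y = 0 \<longleftrightarrow> x \<bullet> y = 0 \<and> (\<i> *s x) \<bullet> y = 0"
proof -
  have "herm_inner (\<i> *s x) y = - \<i> * herm_inner x y"
    by (simp add: herm_inner_def sum_distrib_left mult.assoc sum_negf)
  then have "(\<i> *s x) \<bullet> y = Im (herm_inner x y)"
    by (simp flip: Re_herm_inner)
  then show ?thesis by (simp add: complex_eq_iff Re_herm_inner)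
qed

lemma linear_matrix_complex: "linear ((*v) (A :: complex^'n^'m))"
  by (rule linearI)
    (simp_all add: vec_eq_iff matrix_vector_mult_def scaleR_sum_right distrib_left sum.distrib)

text \<open>Induction on \<open>T\<close>: the orthogonal complement of the vectors found so far is
  invariant under \<open>A\<close>, hence contains a further eigenvector. Indexing by a subset of
  \<open>'n\<close> lets the vectors become the columns of a matrix once \<open>T\<close> is all of
  \<open>'n\<close>.\<close>

lemma hermitian_orthonormal_eigenvectors:
  fixes A :: "complex^'n^'n" and T :: "'n set"
  assumes A: "conj_transpose A = A" and "finite T"
  shows "\<exists>u d. (\<forall>i\<in>T. A *v u i = d i *\<^sub>R u i) \<and>
    (\<forall>i\<in>T. \<forall>j\<in>T. herm_inner (u i) (u j) = (if i = j then 1 else 0))"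
  using \<open>finite T\<close>
proof (induction T rule: finite_induct)
  case (insert k T)
  then obtain u d where
    ev: "\<And>i. i \<in> T \<Longrightarrow> A *v u i = d i *\<^sub>R u i" and
    on: "\<And>i j. i \<in> T \<Longrightarrow> j \<in> T \<Longrightarrow> herm_inner (u i) (u j) = (if i = j then 1 else 0)"
    by blast
  define V where "V = {y. \<forall>i\<in>T. herm_inner (u i) y = 0}"
  have V: "subspace V"
    unfolding subspace_def V_def
    by (simp add: herm_inner_add_right herm_inner_scaleR) (simp add: herm_inner_def)
  have inv: "(*v) A ` V \<subseteq> V"
    by (auto simp: V_def herm_inner_adjoint A ev herm_inner_scaleR)
  \<comment> \<open>At most twice \<open>card T\<close> vectors, while the real dimension of the
    whole space is twice \<open>CARD('n)\<close>. So some nonzero \<open>v\<close> is orthogonal to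
    all of them.\<close>
  let ?B = "u ` T \<union> (\<lambda>i. \<i> *s u i) ` T"
  have "card T < CARD('n)"
    using insert.hyps by (intro psubset_card_mono) auto
  moreover have "dim ?B \<le> card ?B" using insert.hyps by (intro dim_le_card') auto
  moreover have "card ?B \<le> card T + card T"
    using insert.hyps(1)
    by (intro order.trans[OF card_Un_le] add_mono card_image_le)
  ultimately have "dim ?B < DIM(complex^'n)" by simp
  from orthogonal_to_subspace_exists[OF this] obtain v where
    v: "v \<noteq> 0" "\<And>y. y \<in> span ?B \<Longrightarrow> orthogonal v y" by blast
  have "v \<in> V"
    unfolding V_def herm_inner_eq_0_iff
    using v(2)[OF span_base] by (auto simp: orthogonal_def inner_commute[of _ v])
  then have "\<not> V \<subseteq> {0}" using v(1) by blast
  moreover have "x \<bullet> (A *v y) = (A *v x) \<bullet> y" for x y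
    by (simp add: herm_inner_adjoint A flip: Re_herm_inner)
  ultimately obtain x l where x: "x \<in> V" "norm x = 1" "A *v x = l *\<^sub>R x"
    using selfadjoint_eigenvector[OF linear_matrix_complex[of A] _ V inv] by blast
  have xx: "herm_inner x x = 1"
  proof -
    have "Im (herm_inner x x) = 0" using cnj_herm_inner[of x x] by (simp add: complex_eq_iff)
    then show ?thesis using x(2) by (simp add: complex_eq_iff Re_herm_inner dot_square_norm)
  qed
  have ux: "herm_inner (u i) x = 0" "herm_inner x (u i) = 0" if "i \<in> T" for i
    using x(1) that cnj_herm_inner[of "u i" x] by (auto simp: V_def)
  show ?case
    by (rule exI[of _ "u(k := x)"], rule exI[of _ "d(k := l)"])
      (use insert.hyps(2) ev on x(3) xx ux in auto)
qed auto

lemma conj_transpose_mult: "conj_transpose (A ** B) = conj_transpose B ** conj_transpose A"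
  by (simp add: conj_transpose_def matrix_matrix_mult_def vec_eq_iff mult.commute)

lemma conj_transpose_conj_transpose [simp]: "conj_transpose (conj_transpose A) = A"
  by (simp add: conj_transpose_def vec_eq_iff)

lemma conj_transpose_real_diag [simp]: "conj_transpose (real_diag d) = real_diag d"
  by (simp add: conj_transpose_def real_diag_def vec_eq_iff)

lemma hermitian_diagonalization:
  fixes A :: "complex^'n^'n"
  assumes "conj_transpose A = A"
  obtains U d where "unitary U" "A = U ** real_diag d ** conj_transpose U"
proof -
  obtain u :: "'n \<Rightarrow> complex^'n" and d where
    ev: "\<And>i. A *v u i = d i *\<^sub>R u i" and
    on: "\<And>i j. herm_inner (u i) (u j) = (if i = j then 1 else 0)"
    using hermitian_orthonormal_eigenvectors[OF assms finite, of UNIV] by auto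
  define U :: "complex^'n^'n" where "U = (\<chi> i j. u j $ i)"
  have 1: "conj_transpose U ** U = mat 1"
    using on by (simp add: U_def vec_eq_iff matrix_matrix_mult_def conj_transpose_def mat_def herm_inner_def)
  then have 2: "U ** conj_transpose U = mat 1"
    by (simp add: matrix_left_right_inverse)
  have "(A ** U) $ i $ j = (U ** real_diag d) $ i $ j" for i j
  proof -
    have "(A ** U) $ i $ j = (A *v u j) $ i"
      by (simp add: U_def matrix_matrix_mult_def matrix_vector_mult_def)
    then show ?thesis
      by (simp add: ev real_diag_mult U_def scaleR_conv_of_real[where 'a=complex] mult.commute)
  qed
  then have "A ** U = U ** real_diag d" by (simp add: vec_eq_iff)
  then have "A = U ** real_diag d ** conj_transpose U"
    by (metis 2 matrix_mul_assoc matrix_mul_rid)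
  with that 1 2 show ?thesis by (simp add: unitary_def)
qed

subsection \<open>Positive definite matrices and their powers\<close>

lemma pos_def_mats_iff:
  "A \<in> \<bbbP> \<longleftrightarrow> conj_transpose A = A \<and> (\<forall>x. x \<noteq> 0 \<longrightarrow> 0 < x \<bullet> (A *v x))"
  by (simp add: pos_def_mats_def herm_inner_def flip: Re_herm_inner)

lemma inner_adjoint: "x \<bullet> (A *v y) = (conj_transpose A *v x) \<bullet> (y :: complex^'n)"
  by (simp add: herm_inner_adjoint flip: Re_herm_inner)

text \<open>The form of the new matrix at \<open>x\<close> is the form of \<open>A\<close> at
  \<open>M *v x\<close>; the left inverse \<open>N\<close> keeps \<open>M *v x\<close>
  nonzero.\<close>

lemma pos_def_congruence:
  fixes A M N :: "complex^'n^'n"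
  assumes A: "A \<in> \<bbbP>" and M: "N ** M = mat 1"
  shows "conj_transpose M ** A ** M \<in> \<bbbP>"
proof -
  have "M *v x \<noteq> 0" if "x \<noteq> 0" for x
    using that M by (metis matrix_vector_mul_assoc matrix_vector_mul_lid matrix_vector_mult_0_right)
  moreover have "x \<bullet> (conj_transpose M ** A ** M *v x) = (M *v x) \<bullet> (A *v (M *v x))" for x
    by (simp add: inner_adjoint[of x "conj_transpose M"] flip: matrix_vector_mul_assoc)
  ultimately show ?thesis
    using A by (simp add: pos_def_mats_iff conj_transpose_mult matrix_mul_assoc)
qed

lemma real_diag_mult_vec: "(real_diag d *v x) $ i = of_real (d i) * x $ i"
  by (simp add: real_diag_def matrix_vector_mult_def if_distrib if_distribR cong: if_cong)

lemma pos_def_real_diag_iff: "real_diag d \<in> \<bbbP> \<longleftrightarrow> (\<forall>i. 0 < d i)"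
proof -
  have q: "x \<bullet> (real_diag d *v x) = (\<Sum>i\<in>UNIV. d i * (cmod (x $ i))\<^sup>2)" for x
    by (simp add: inner_vec_def real_diag_mult_vec inner_complex_def cmod_power2)
      (simp add: power2_eq_square algebra_simps)
  show ?thesis
  proof
    assume P: "real_diag d \<in> \<bbbP>"
    show "\<forall>i. 0 < d i"
    proof
      fix k
      have "0 < (axis k 1 :: complex^'a) \<bullet> (real_diag d *v axis k 1)"
        using P by (simp add: pos_def_mats_iff)
      also have "\<dots> = (\<Sum>i\<in>UNIV. if i = k then d k else 0)"
        unfolding q by (intro sum.cong) (auto simp: axis_def)
      finally show "0 < d k" by simp
    qed
  next
    assume d: "\<forall>i. 0 < d i"
    have "0 < (\<Sum>i\<in>UNIV. d i * (cmod (x $ i))\<^sup>2)" if x: "x \<noteq> 0" for x :: "complex^'a"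
    proof -
      obtain k where "x $ k \<noteq> 0" using x by (auto simp: vec_eq_iff)
      then show ?thesis using d
        by (intro sum_pos2[of _ k]) (simp_all add: less_imp_le)
    qed
    then show "real_diag d \<in> \<bbbP>" by (simp add: pos_def_mats_iff q)
  qed
qed

text \<open>The diagonal factor is congruent to \<open>A\<close> through \<open>U\<close>, so it
  inherits positivity and its entries must be positive.\<close>

lemma pos_def_diagonalization:
  fixes A :: "complex^'n^'n"
  assumes "A \<in> \<bbbP>"
  obtains U d where "unitary U" "\<And>i. 0 < d i" "A = U ** real_diag d ** conj_transpose U"
proof -
  obtain U d where U: "unitary U" and A: "A = U ** real_diag d ** conj_transpose U"
    using hermitian_diagonalization assms unfolding pos_def_mats_iff by blast
  have "conj_transpose U ** A ** U \<in> \<bbbP>"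
    using U by (intro pos_def_congruence[OF assms, of "conj_transpose U"]) (simp add: unitary_def)
  also have "conj_transpose U ** A ** U = real_diag d"
    unfolding A using U unfolding unitary_def
    by (metis matrix_mul_assoc matrix_mul_rid matrix_mul_lid)
  finally show ?thesis using that[OF U _ A] by (simp add: pos_def_real_diag_iff)
qed

section \<open>Functional calculus and exponent laws\<close>

text \<open>By uniqueness, the definite description may be evaluated in any positive
  diagonalization. This reduces the exponent laws to those of real numbers.\<close>

lemma mat_powr_diag:
  assumes "unitary U" "\<And>i. 0 < d i"
  shows "(U ** real_diag d ** conj_transpose U) \<up> t
    = U ** real_diag (\<lambda>i. d i powr t) ** conj_transpose U"
  unfolding mat_powr_def
proof -
  have "is_mat_powr (U ** real_diag d ** conj_transpose U) t
      (U ** real_diag (\<lambda>i. d i powr t) ** conj_transpose U)"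
    unfolding is_mat_powr_def using assms by blast
  then show "(THE X. is_mat_powr (U ** real_diag d ** conj_transpose U) t X)
      = U ** real_diag (\<lambda>i. d i powr t) ** conj_transpose U"
    using is_mat_powr_unique by blast
qed

lemma unitary_diag_pos_def:
  assumes "unitary U" "\<And>i. 0 < d i"
  shows "U ** real_diag d ** conj_transpose U \<in> \<bbbP>"
  using pos_def_congruence[of "real_diag d" U "conj_transpose U"] assms
  by (simp add: pos_def_real_diag_iff unitary_def)

lemma mat_powr_pos_def: "A \<in> \<bbbP> \<Longrightarrow> A \<up> t \<in> \<bbbP>"
  by (erule pos_def_diagonalization) (metis mat_powr_diag unitary_diag_pos_def powr_gt_zero less_irrefl)

lemma mat_powr_powr: "A \<in> \<bbbP> \<Longrightarrow> (A \<up> s) \<up> t = A \<up> (s * t)"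
  by (erule pos_def_diagonalization) (simp add: mat_powr_diag powr_powr powr_gt_zero less_imp_neq[symmetric])

lemma mat_powr_1: "A \<in> \<bbbP> \<Longrightarrow> A \<up> 1 = A"
  by (erule pos_def_diagonalization) (simp add: mat_powr_diag less_imp_le)

lemma mat_powr_0: "A \<in> \<bbbP> \<Longrightarrow> A \<up> 0 = mat 1"
proof (erule pos_def_diagonalization)
  fix U and d :: "'a \<Rightarrow> real"
  assume *: "unitary U" "\<And>i. 0 < d i" and A: "A = U ** real_diag d ** conj_transpose U"
  \<comment> \<open>Positivity of the entries matters here, since
    \<open>0 powr 0 = 0\<close>.\<close>
  have "real_diag (\<lambda>i. d i powr 0) = (mat 1 :: complex^'a^'a)"
    using *(2) by (simp add: real_diag_def mat_def vec_eq_iff less_imp_neq[symmetric])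
  then show ?thesis using * by (simp add: A mat_powr_diag unitary_def)
qed

lemma mat_powr_add: "A \<in> \<bbbP> \<Longrightarrow> A \<up> s ** A \<up> t = A \<up> (s + t)"
proof (erule pos_def_diagonalization)
  fix U and d :: "'a \<Rightarrow> real"
  assume *: "unitary U" "\<And>i. 0 < d i" and A: "A = U ** real_diag d ** conj_transpose U"
  have "A \<up> s ** A \<up> t = U ** real_diag (\<lambda>i. d i powr s) ** (conj_transpose U ** U) **
      real_diag (\<lambda>i. d i powr t) ** conj_transpose U"
    using * by (simp add: A mat_powr_diag matrix_mul_assoc)
  also have "\<dots> = U ** (real_diag (\<lambda>i. d i powr s) ** real_diag (\<lambda>i. d i powr t)) ** conj_transpose U"
    using * by (simp add: unitary_def matrix_mul_assoc)
  also have "real_diag (\<lambda>i. d i powr s) ** real_diag (\<lambda>i. d i powr t)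
      = (real_diag (\<lambda>i. d i powr (s + t)) :: complex^'a^'a)"
    by (simp add: vec_eq_iff real_diag_mult) (simp add: real_diag_def powr_add)
  finally show ?thesis using * by (simp add: A mat_powr_diag)
qed

text \<open>For square matrices a right inverse is two-sided, and two-sided inverses are unique, so
  the choice made in \<open>matrix_inv\<close> is determined.\<close>

lemma matrix_inv_eqI:
  fixes A B :: "complex^'n^'n"
  assumes "A ** B = mat 1"
  shows "matrix_inv A = B"
proof -
  have BA: "B ** A = mat 1" using assms by (simp add: matrix_left_right_inverse)
  have "A ** matrix_inv A = mat 1 \<and> matrix_inv A ** A = mat 1"
    unfolding matrix_inv_def by (rule someI[of _ B]) (use assms BA in simp)
  then show ?thesis by (metis BA matrix_mul_assoc matrix_mul_lid matrix_mul_rid)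
qed

lemma matrix_inv_eq_powr: "A \<in> \<bbbP> \<Longrightarrow> matrix_inv A = A \<up> (-1)"
  using mat_powr_add[of A 1 "-1"] by (intro matrix_inv_eqI) (simp add: mat_powr_0 mat_powr_1)

lemma matrix_inv_pos_def: "A \<in> \<bbbP> \<Longrightarrow> matrix_inv A \<in> \<bbbP>"
  by (simp add: matrix_inv_eq_powr mat_powr_pos_def)

lemma matrix_inv_powr: "A \<in> \<bbbP> \<Longrightarrow> matrix_inv A \<up> t = A \<up> (- t)"
  by (simp add: matrix_inv_eq_powr mat_powr_powr)

lemma pos_def_congruence_pos_def:
  assumes "M \<in> \<bbbP>" "A \<in> \<bbbP>"
  shows "M ** A ** M \<in> \<bbbP>"
  using pos_def_congruence[OF assms(2), of "M \<up> (-1)" M] assms(1) mat_powr_add[of M "-1" 1]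
  by (simp add: mat_powr_0 mat_powr_1) (simp add: pos_def_mats_iff)

lemma geo_mean_pos_def: "A \<in> \<bbbP> \<Longrightarrow> B \<in> \<bbbP> \<Longrightarrow> geo_mean t A B \<in> \<bbbP>"
  unfolding geo_mean_def by (intro pos_def_congruence_pos_def mat_powr_pos_def)

subsection \<open>Gyrolines and cogyrolines\<close>

lemma gyro_inv_add_self:
  assumes "A \<in> \<bbbP>" shows "\<ominus> A \<oplus> A = mat 1"
proof -
  have "\<ominus> A \<oplus> A = A \<up> (-1/2) ** A \<up> 1 ** A \<up> (-1/2)"
    using assms by (simp add: gyro_add_def gyro_inv_def matrix_inv_powr mat_powr_1)
  also have "\<dots> = mat 1" using assms by (simp add: mat_powr_add mat_powr_0)
  finally show ?thesis .
qed

lemma gyro_add_mat_1: "A \<in> \<bbbP> \<Longrightarrow> A \<oplus> mat 1 = A"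
  by (simp add: gyro_add_def mat_powr_add mat_powr_1)

text \<open>The right-hand side is the matrix whose square root sits in the middle of
  \<open>geo_mean (1/2) X B\<close>; this links the gyration to the geometric mean.\<close>

lemma gyro_inv_add:
  assumes X: "X \<in> \<bbbP>" and B: "B \<in> \<bbbP>"
  shows "\<ominus> (X \<oplus> \<ominus> B) = X \<up> (-1/2) ** B ** X \<up> (-1/2)"
  unfolding gyro_inv_def gyro_add_def
proof (rule matrix_inv_eqI)
  have h: "X \<up> (1/2) ** X \<up> (-1/2) = mat 1" and b: "matrix_inv B ** B = mat 1"
    using X B mat_powr_add[of B "-1" 1]
    by (simp_all add: mat_powr_add mat_powr_0 mat_powr_1 matrix_inv_eq_powr)
  have "X \<up> (1/2) ** matrix_inv B ** X \<up> (1/2) ** (X \<up> (-1/2) ** B ** X \<up> (-1/2))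
      = X \<up> (1/2) ** (matrix_inv B ** (X \<up> (1/2) ** X \<up> (-1/2)) ** B) ** X \<up> (-1/2)"
    by (simp only: matrix_mul_assoc)
  then show "X \<up> (1/2) ** matrix_inv B ** X \<up> (1/2) ** (X \<up> (-1/2) ** B ** X \<up> (-1/2)) = mat 1"
    by (simp only: h b matrix_mul_rid)
qed

lemma gyro_coadd_eq_geo_mean_square:
  assumes X: "X \<in> \<bbbP>" and B: "B \<in> \<bbbP>"
  shows "X \<boxplus> B = geo_mean (1/2) X B \<up> 2"
proof -
  define E where "E = (X \<up> (-1/2) ** B ** X \<up> (-1/2)) \<up> (1/2)"
  have "gyr X (\<ominus> B) B = E ** X ** E"
    unfolding gyr_def gyro_inv_add_self[OF B] gyro_add_mat_1[OF X] gyro_inv_add[OF X B]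
    by (simp add: gyro_add_def E_def)
  then have "X \<boxplus> B = X \<up> (1/2) ** (E ** X ** E) ** X \<up> (1/2)"
    by (simp only: gyro_coadd_def gyro_add_def)
  \<comment> \<open>Splitting the middle \<open>X\<close> into two square roots exposes two adjacent
    copies of the geometric mean.\<close>
  also have "\<dots> = X \<up> (1/2) ** (E ** (X \<up> (1/2) ** X \<up> (1/2)) ** E) ** X \<up> (1/2)"
    using X by (simp add: mat_powr_add mat_powr_1)
  also have "\<dots> = geo_mean (1/2) X B ** geo_mean (1/2) X B"
    by (simp only: geo_mean_def E_def[symmetric] matrix_mul_assoc)
  also have "\<dots> = geo_mean (1/2) X B \<up> 1 ** geo_mean (1/2) X B \<up> 1"
    using X B by (simp add: mat_powr_1 geo_mean_pos_def)
  also have "\<dots> = geo_mean (1/2) X B \<up> 2"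
    using X B by (simp only: mat_powr_add geo_mean_pos_def) simp
  finally show ?thesis .
qed

theorem theorem4p9:
  fixes A B :: "complex^'n^'n" and t :: real
  assumes "A \<in> \<bbbP>" and "B \<in> \<bbbP>" and "t \<in> {0..1}"
  shows "gyroline t A B = geo_mean t A B \<and> cogyroline t A B = spectral_geo_mean t A B"
proof
  show "gyroline t A B = geo_mean t A B"
    using assms(1)
    by (simp add: gyroline_def geo_mean_def gyro_add_def gyro_scale_def gyro_inv_def matrix_inv_powr)
  \<comment> \<open>Let \<open>G\<close> be this mean. The coaddition yields
    \<open>G \<up> 2\<close>, scaling by \<open>t\<close> yields \<open>G \<up> (2 * t)\<close>, and
    the half power in the outer gyroaddition leaves \<open>G \<up> t\<close> on both sides of
    \<open>A\<close>.\<close>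
  have "geo_mean (1/2) (matrix_inv A) B \<in> \<bbbP>"
    using assms by (intro geo_mean_pos_def matrix_inv_pos_def)
  then show "cogyroline t A B = spectral_geo_mean t A B"
    using assms(1,2)
    by (simp add: cogyroline_def spectral_geo_mean_def gyro_add_def gyro_scale_def gyro_inv_def
        gyro_coadd_eq_geo_mean_square matrix_inv_pos_def mat_powr_powr)
qed

end
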